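(* Let $C$ be a curve in the Myller configuration $M(C,\bar\xi,\pi)$ with invariant Frenet-type frame $R_F=\{P(s);\bar\xi_1(s),\bar\xi_2(s),\bar\xi_3(s)\}$ and with curvatures $(K_1,K_2)\neq(0,0)$. Then $C$ is a slant helix if and only if the function $$\sigma=\cot\theta=\mp\frac{K_1^2}{(K_1^2+K_2^2)^{3/2}}\left(\frac{K_2}{K_1}\right)'$$ is constant. (Here $\mp$ means one of the two signs, the same for all $s$, and, for a slant helix, $\theta$ is the constant angle between $\bar\xi_2$ and the fixed direction.)
   Context: All data are smooth. Let $C$ be a curve in Euclidean space $E^3$ with arclength parameter $s\in I$ ($I$ an interval) and position vector $\bar r(s)$, let $\bar\xi(s)$ be a unit vector field along $C$ (a versor field $(C,\bar\xi)$), and let $\pi(s)$ be a plane field along $C$ with $\bar\xi(s)\in\pi(s)$. The pair $((C,\bar\xi),(C,\pi))$ is called a Myller configuration $M=M(C,\bar\xi,\pi)$. Put $\bar\xi_1=\bar\xi$, $K_1=\|d\bar\xi/ds\|>0$ (curvature), define $\bar\xi_2$ by $\bar\xi_1'=K_1\bar\xi_2$, and $\bar\xi_3=\bar\xi_1\times\bar\xi_2$. Then $R_F=\{P(s);\bar\xi_1,\bar\xi_2,\bar\xi_3\}$ is a positively oriented orthonormal frame, the Frenet-type frame, and $$\bar\xi_1'=K_1\bar\xi_2,\quad \bar\xi_2'=-K_1\bar\xi_1+K_2\bar\xi_3,\quad \bar\xi_3'=-K_2\bar\xi_2,$$ which defines the torsion $K_2$. Moreover $\bar r'=\bar\alpha=a_1\bar\xi_1+a_2\bar\xi_2+a_3\bar\xi_3$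 with $a_1^2+a_2^2+a_3^2=1$. A prime denotes $d/ds$. The curve $C$ is called a slant helix (or $\bar\xi_2$-helix) in $M$ if $\bar\xi_2$ makes a constant angle $\theta$ with a fixed unit vector $\bar d$, i.e. $\langle\bar\xi_2,\bar d\rangle=\cos\theta$ is constant. *)

theory Defs
  imports "HOL-Analysis.Analysis"
begin

text \<open>
  All derivatives are taken within the parameter interval, so that they are one-sided at an end
  point belonging to the interval and coincide with the usual derivative in the interior.
\<close>

definition parameter_interval :: "real set \<Rightarrow> bool"
  where "parameter_interval I \<longleftrightarrow> is_interval I \<and> interior I \<noteq> {}"

abbreviation deriv_along :: "real set \<Rightarrow> (real \<Rightarrow> 'a::real_normed_vector) \<Rightarrow> real \<Rightarrow> 'a"
  where "deriv_along I f s \<equiv> vector_derivative f (at s within I)"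

definition smooth_along :: "real set \<Rightarrow> (real \<Rightarrow> 'a::real_normed_vector) \<Rightarrow> bool"
  where "smooth_along I f \<longleftrightarrow>
    (\<exists>F :: nat \<Rightarrow> real \<Rightarrow> 'a. (\<forall>s\<in>I. F 0 s = f s) \<and>
      (\<forall>n. \<forall>s\<in>I. (F n has_vector_derivative F (Suc n) s) (at s within I)))"

text \<open>
  A plane attached to the point \<open>r s\<close> of the curve is represented by its two-dimensional space
  of directions. Smoothness of a plane field means that it is locally spanned by smooth
  vector fields.
\<close>

definition plane_field :: "real set \<Rightarrow> (real \<Rightarrow> (real^3) set) \<Rightarrow> bool"
  where "plane_field I \<pi> \<longleftrightarrow>
    (\<forall>s\<in>I. subspace (\<pi> s) \<and> dim (\<pi> s) = 2) \<and>
    (\<forall>s\<in>I. \<exists>U u v. open U \<and> s \<in> U \<and> smooth_along (I \<inter> U) u \<and> smooth_along (I \<inter> U) v \<and>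
       (\<forall>t\<in>I \<inter> U. \<pi> t = span {u t, v t}))"

definition myller_configuration ::
    "real set \<Rightarrow> (real \<Rightarrow> real^3) \<Rightarrow> (real \<Rightarrow> real^3) \<Rightarrow> (real \<Rightarrow> (real^3) set) \<Rightarrow> bool"
  where "myller_configuration I r \<xi> \<pi> \<longleftrightarrow>
    parameter_interval I \<and>
    smooth_along I r \<and> (\<forall>s\<in>I. norm (deriv_along I r s) = 1) \<and>
    smooth_along I \<xi> \<and> (\<forall>s\<in>I. norm (\<xi> s) = 1) \<and>
    plane_field I \<pi> \<and> (\<forall>s\<in>I. \<xi> s \<in> \<pi> s)"

definition K1 :: "real set \<Rightarrow> (real \<Rightarrow> real^3) \<Rightarrow> real \<Rightarrow> real"
  where "K1 I \<xi> s = norm (deriv_along I \<xi> s)"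

definition xi2 :: "real set \<Rightarrow> (real \<Rightarrow> real^3) \<Rightarrow> real \<Rightarrow> real^3"
  where "xi2 I \<xi> s = (1 / K1 I \<xi> s) *\<^sub>R deriv_along I \<xi> s"

definition xi3 :: "real set \<Rightarrow> (real \<Rightarrow> real^3) \<Rightarrow> real \<Rightarrow> real^3"
  where "xi3 I \<xi> s = cross3 (\<xi> s) (xi2 I \<xi> s)"

text \<open>
  The torsion is the coefficient of \<open>xi3\<close> in the derivative of \<open>xi2\<close>; lemma \<open>frenet_formulas\<close>
  below shows that this is the function determined by the Frenet-type equations.
\<close>

definition K2 :: "real set \<Rightarrow> (real \<Rightarrow> real^3) \<Rightarrow> real \<Rightarrow> real"
  where "K2 I \<xi> s = deriv_along I (xi2 I \<xi>) s \<bullet> xi3 I \<xi> s"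

definition makes_constant_angle ::
    "real set \<Rightarrow> (real \<Rightarrow> real^3) \<Rightarrow> real^3 \<Rightarrow> real \<Rightarrow> bool"
  where "makes_constant_angle I v d \<theta> \<longleftrightarrow>
    norm d = 1 \<and> 0 \<le> \<theta> \<and> \<theta> \<le> pi \<and> (\<forall>s\<in>I. v s \<bullet> d = cos \<theta>)"

definition slant_helix :: "real set \<Rightarrow> (real \<Rightarrow> real^3) \<Rightarrow> bool"
  where "slant_helix I \<xi> \<longleftrightarrow> (\<exists>d \<theta>. makes_constant_angle I (xi2 I \<xi>) d \<theta>)"

definition slant_sigma :: "real set \<Rightarrow> (real \<Rightarrow> real^3) \<Rightarrow> real \<Rightarrow> real"
  where "slant_sigma I \<xi> s =
    (K1 I \<xi> s)\<^sup>2 / ((K1 I \<xi> s)\<^sup>2 + (K2 I \<xi> s)\<^sup>2) powr (3/2) *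
    deriv_along I (\<lambda>t. K2 I \<xi> t / K1 I \<xi> t) s"

lemma orthonormal_expansion:
  fixes a b x :: "real^3"
  assumes "a \<bullet> a = 1" "b \<bullet> b = 1" "a \<bullet> b = 0"
  shows "x = (x \<bullet> a) *\<^sub>R a + (x \<bullet> b) *\<^sub>R b + (x \<bullet> cross3 a b) *\<^sub>R cross3 a b"
proof -
  let ?c = "cross3 a b"
  define y where "y = x - ((x \<bullet> a) *\<^sub>R a + (x \<bullet> b) *\<^sub>R b + (x \<bullet> ?c) *\<^sub>R ?c)"
  have c: "?c \<bullet> ?c = 1" using assms by (simp add: dot_cross inner_commute)
  have ca: "?c \<bullet> a = 0" "?c \<bullet> b = 0" "a \<bullet> ?c = 0" "b \<bullet> ?c = 0" by (simp_all add: dot_cross_self)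
  have ba: "b \<bullet> a = 0" using assms by (simp add: inner_commute)
  have y: "y \<bullet> a = 0" "y \<bullet> b = 0" "y \<bullet> ?c = 0"
    using assms ca c ba by (simp_all add: y_def inner_diff_left inner_add_left)
  have "cross3 y ?c = (y \<bullet> b) *\<^sub>R a - (y \<bullet> a) *\<^sub>R b"
    by (simp add: Lagrange)
  hence "cross3 y ?c = 0" using y by simp
  with norm_cross_dot[of y ?c] y have "(norm y * norm ?c)\<^sup>2 = 0" by simp
  moreover have "norm ?c = 1" using c by (simp add: norm_eq_sqrt_inner)
  ultimately have "y = 0" by simp
  thus ?thesis by (simp add: y_def)
qed

lemma at_within_parameter_interval:
  assumes "parameter_interval I" "s \<in> I"
  shows "at s within I \<noteq> bot"
proof -
  have "I \<noteq> {s}" using assms by (auto simp: parameter_interval_def)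
  moreover have "connected I" using assms by (simp add: parameter_interval_def is_interval_connected)
  ultimately have "s islimpt I" using assms connected_imp_perfect by blast
  thus ?thesis by (simp add: trivial_limit_within)
qed

lemma frenet_formulas:
  assumes I: "parameter_interval I" and s: "s \<in> I"
    and sm: "smooth_along I \<xi>" and unit: "\<forall>t\<in>I. norm (\<xi> t) = 1" and pos: "\<forall>t\<in>I. K1 I \<xi> t > 0"
  shows "(\<xi> has_vector_derivative K1 I \<xi> s *\<^sub>R xi2 I \<xi> s) (at s within I)"
    and "(xi2 I \<xi> has_vector_derivative - K1 I \<xi> s *\<^sub>R \<xi> s + K2 I \<xi> s *\<^sub>R xi3 I \<xi> s) (at s within I)"
    and "(xi3 I \<xi> has_vector_derivative - K2 I \<xi> s *\<^sub>R xi2 I \<xi> s) (at s within I)"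
proof -
  note nt = at_within_parameter_interval[OF I]
  have uniq: "a = b" if "(f has_vector_derivative a) (at t within I)"
      "(f has_vector_derivative b) (at t within I)" "t \<in> I" for f :: "real \<Rightarrow> 'z::real_normed_vector" and a b t
    using that nt[OF that(3)] vector_derivative_unique_within by blast
  obtain F where F0: "\<And>t. t \<in> I \<Longrightarrow> F 0 t = \<xi> t"
    and F: "\<And>n t. t \<in> I \<Longrightarrow> (F n has_vector_derivative F (Suc n) t) (at t within I)"
    using sm unfolding smooth_along_def by metis
  have x1: "(\<xi> has_vector_derivative F 1 t) (at t within I)" if "t \<in> I" for t
    by (rule has_vector_derivative_transform[OF that _ F[OF that, of 0, folded One_nat_def]]) (simp add: F0)
  have D: "deriv_along I \<xi> t = F 1 t" if "t \<in> I" for t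
    using vector_derivative_within[OF nt[OF that] x1[OF that]] .
  have K: "K1 I \<xi> t = norm (F 1 t)" if "t \<in> I" for t using D that by (simp add: K1_def)
  have nz: "F 1 t \<noteq> 0" if "t \<in> I" for t using K pos that by fastforce
  have dx: "K1 I \<xi> t *\<^sub>R xi2 I \<xi> t = F 1 t" if "t \<in> I" for t
    using nz[OF that] K[OF that] D[OF that] by (simp add: xi2_def)
  show first: "(\<xi> has_vector_derivative K1 I \<xi> s *\<^sub>R xi2 I \<xi> s) (at s within I)"
    using dx x1 s by simp
  have n2: "xi2 I \<xi> t \<bullet> xi2 I \<xi> t = 1" if "t \<in> I" for t
  proof -
    have "norm (xi2 I \<xi> t) = 1"
      using nz[OF that] K[OF that] D[OF that] by (simp add: xi2_def)
    thus ?thesis by (simp add: dot_square_norm)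
  qed
  have n1: "\<xi> t \<bullet> \<xi> t = 1" if "t \<in> I" for t using unit that by (simp add: dot_square_norm)
  have inner_deriv: "f s \<bullet> g' + f' \<bullet> g s = 0"
    if "(f has_vector_derivative f') (at s within I)" "(g has_vector_derivative g') (at s within I)"
      "\<And>t. t \<in> I \<Longrightarrow> f t \<bullet> g t = c" "s \<in> I" for f g :: "real \<Rightarrow> real^3" and f' g' c s
  proof -
    have "((\<lambda>t. f t \<bullet> g t) has_vector_derivative (f s \<bullet> g' + f' \<bullet> g s)) (at s within I)"
      by (rule bounded_bilinear.has_vector_derivative[OF bounded_bilinear_inner that(1,2)])
    moreover have "((\<lambda>t. f t \<bullet> g t) has_vector_derivative 0) (at s within I)"
      by (rule has_vector_derivative_transform[OF that(4) _ has_vector_derivative_const[of c]])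
         (use that in auto)
    ultimately show ?thesis using uniq that(4) by blast
  qed
  have o12: "\<xi> t \<bullet> xi2 I \<xi> t = 0" if "t \<in> I" for t
    using inner_deriv[OF x1[OF that] x1[OF that], of 1] n1 that D[OF that]
    by (simp add: xi2_def inner_commute)
  have "(\<lambda>t. (1 / norm (F 1 t)) *\<^sub>R F 1 t) differentiable (at s within I)"
  proof -
    have 1: "F 1 differentiable (at s within I)"
      using F[OF s, of 1] by (auto simp: has_vector_derivative_def differentiable_def)
    have 2: "norm differentiable (at (F 1 s) within F 1 ` I)"
      using nz[OF s] differentiable_norm_at differentiable_at_withinI by blast
    from differentiable_chain_within[OF 1 2]
    have "(\<lambda>t. norm (F 1 t)) differentiable (at s within I)" by (simp add: o_def)
    with 1 nz[OF s] show ?thesis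
      by (intro differentiable_scaleR differentiable_divide) auto
  qed
  then obtain g where g': "((\<lambda>t. (1 / norm (F 1 t)) *\<^sub>R F 1 t) has_vector_derivative g) (at s within I)"
    by (auto simp: vector_derivative_works)
  have g: "(xi2 I \<xi> has_vector_derivative g) (at s within I)"
    by (rule has_vector_derivative_transform[OF s _ g']) (simp add: xi2_def K D)
  have Dg: "deriv_along I (xi2 I \<xi>) s = g" using vector_derivative_within[OF nt[OF s] g] .
  have "g \<bullet> xi2 I \<xi> s = 0"
    using inner_deriv[OF g g n2 s] by (simp add: inner_commute)
  moreover have "g \<bullet> \<xi> s = - K1 I \<xi> s"
    using inner_deriv[OF first g o12 s] n2[OF s] by (simp add: inner_commute)
  ultimately have g_eq: "g = - K1 I \<xi> s *\<^sub>R \<xi> s + K2 I \<xi> s *\<^sub>R xi3 I \<xi> s"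
    using orthonormal_expansion[OF n1[OF s] n2[OF s] o12[OF s], of g]
    by (simp add: K2_def Dg xi3_def)
  show second: "(xi2 I \<xi> has_vector_derivative - K1 I \<xi> s *\<^sub>R \<xi> s + K2 I \<xi> s *\<^sub>R xi3 I \<xi> s) (at s within I)"
    using g g_eq by simp
  have "bounded_bilinear cross3"
    using bilinear_cross by (simp add: bilinear_conv_bounded_bilinear)
  from bounded_bilinear.has_vector_derivative[OF this first second]
  have "(xi3 I \<xi> has_vector_derivative
      cross3 (\<xi> s) (- K1 I \<xi> s *\<^sub>R \<xi> s + K2 I \<xi> s *\<^sub>R xi3 I \<xi> s) + cross3 (K1 I \<xi> s *\<^sub>R xi2 I \<xi> s) (xi2 I \<xi> s))
      (at s within I)"
    by (simp add: xi3_def [abs_def])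
  moreover have "cross3 (\<xi> s) (xi3 I \<xi> s) = - xi2 I \<xi> s"
    using o12[OF s] n1[OF s] by (simp add: xi3_def Lagrange)
  ultimately show "(xi3 I \<xi> has_vector_derivative - K2 I \<xi> s *\<^sub>R xi2 I \<xi> s) (at s within I)"
    by (simp add: cross_add_right cross_mult_right cross_mult_left cross_minus_right
        del: add_uminus_conv_diff uminus_add_conv_diff)
qed

end

theory Submission
  imports Defs
begin

text \<open>
  Write \<open>q = K2 / K1\<close>. The angular velocity of the Frenet-type frame points along the unit
  vector \<open>W = (q \<xi>1 + \<xi>3) / sqrt (1 + q\<^sup>2)\<close>. Both \<open>\<xi>2'\<close> and \<open>W'\<close> are orthogonal to \<open>\<xi>2\<close> and
  to \<open>W\<close>, hence parallel, and the proportionality factor is the function in question: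
  \<open>W' = - \<sigma> \<xi>2'\<close> (lemma \<open>deriv_darboux_axis\<close>). Everything follows from this identity.

  If \<open>\<sigma>\<close> is a constant \<open>c\<close>, then \<open>W + c \<xi>2\<close> is a constant vector of length \<open>sqrt (1 + c\<^sup>2)\<close>, and
  its inner product with \<open>\<xi>2\<close> is \<open>c\<close>; so its direction is an axis of a slant helix
  (lemma \<open>slant_helix_if_constant_sigma\<close>).

  Conversely, let \<open>\<langle>\<xi>2, d\<rangle> = cos \<theta>\<close> be constant. Then \<open>\<langle>\<xi>2', d\<rangle> = 0\<close>, so the identity makes
  \<open>w = \<langle>W, d\<rangle>\<close> constant too. As \<open>d\<close> lies in the plane of \<open>\<xi>2\<close> and \<open>W\<close>, its unit length gives
  \<open>w\<^sup>2 = sin\<^sup>2 \<theta>\<close>. Differentiating \<open>\<langle>\<xi>2', d\<rangle> = 0\<close> once more gives \<open>cos \<theta> = \<sigma> w\<close>. Thus \<open>w\<close> cannot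
  vanish, as then \<open>sin \<theta>\<close> and \<open>cos \<theta>\<close> would both be zero, and \<open>cot \<theta> = \<plusminus> \<sigma>\<close> where the sign is
  that of the constant \<open>w\<close> (lemma \<open>constant_angle_imp_cot\<close>).
\<close>

locale frenet_type_frame =
  fixes I :: "real set" and \<xi> :: "real \<Rightarrow> real^3"
  assumes interval: "parameter_interval I"
    and smooth: "smooth_along I \<xi>"
    and unit: "\<forall>t\<in>I. norm (\<xi> t) = 1"
    and K1_pos: "\<forall>t\<in>I. K1 I \<xi> t > 0"
begin

definition torsion_ratio :: "real \<Rightarrow> real"
  where "torsion_ratio t = K2 I \<xi> t / K1 I \<xi> t"

definition darboux_axis :: "real \<Rightarrow> real^3"
  where "darboux_axis t = (torsion_ratio t / sqrt (1 + (torsion_ratio t)\<^sup>2)) *\<^sub>R \<xi> t +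
    (1 / sqrt (1 + (torsion_ratio t)\<^sup>2)) *\<^sub>R xi3 I \<xi> t"

section \<open>The Frenet-type frame over an interval\<close>

lemmas frenet = frenet_formulas[OF interval _ smooth unit K1_pos]

lemma convex_interval: "convex I"
  using interval by (simp add: parameter_interval_def is_interval_convex)

lemma deriv_unique:
  assumes "s \<in> I" "(f has_vector_derivative a) (at s within I)"
    "(f has_vector_derivative b) (at s within I)"
  shows "a = b"
  using assms at_within_parameter_interval[OF interval] vector_derivative_unique_within by blast

lemma deriv_of_constant_zero:
  assumes "s \<in> I" "(f has_vector_derivative a) (at s within I)" "\<And>t. t \<in> I \<Longrightarrow> f t = c"
  shows "a = 0"
proof -
  have "(f has_vector_derivative 0) (at s within I)"
    by (rule has_vector_derivative_transform[OF assms(1) _ has_vector_derivative_const[of c]])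
      (simp add: assms(3))
  thus ?thesis using deriv_unique assms(1,2) by blast
qed

lemma deriv_zero_imp_constant:
  fixes f :: "real \<Rightarrow> 'a::real_normed_vector"
  assumes "\<And>s. s \<in> I \<Longrightarrow> (f has_vector_derivative 0) (at s within I)"
  obtains c where "\<And>s. s \<in> I \<Longrightarrow> f s = c"
proof -
  from has_vector_derivative_zero_constant[OF convex_interval assms]
  obtain c where "\<And>s. s \<in> I \<Longrightarrow> f s = c" by blast
  thus thesis by (rule that)
qed

lemma K2_eq: "s \<in> I \<Longrightarrow> K2 I \<xi> s = torsion_ratio s * K1 I \<xi> s"
  using K1_pos by (force simp: torsion_ratio_def)

lemma frame_orthonormal:
  assumes "s \<in> I"
  shows "\<xi> s \<bullet> \<xi> s = 1" "xi2 I \<xi> s \<bullet> xi2 I \<xi> s = 1" "xi3 I \<xi> s \<bullet> xi3 I \<xi> s = 1"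
    "\<xi> s \<bullet> xi2 I \<xi> s = 0" "\<xi> s \<bullet> xi3 I \<xi> s = 0" "xi2 I \<xi> s \<bullet> xi3 I \<xi> s = 0"
proof -
  have n1: "\<xi> t \<bullet> \<xi> t = 1" if "t \<in> I" for t using unit that by (simp add: dot_square_norm)
  thus "\<xi> s \<bullet> \<xi> s = 1" using assms .
  have "norm (xi2 I \<xi> s) = 1"
    using K1_pos assms by (auto simp: xi2_def K1_def)
  thus n2: "xi2 I \<xi> s \<bullet> xi2 I \<xi> s = 1" by (simp add: dot_square_norm)
  note D = frenet(1)[OF assms]
  have "\<xi> s \<bullet> (K1 I \<xi> s *\<^sub>R xi2 I \<xi> s) + (K1 I \<xi> s *\<^sub>R xi2 I \<xi> s) \<bullet> \<xi> s = 0"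
    by (rule deriv_of_constant_zero[OF assms
          bounded_bilinear.has_vector_derivative[OF bounded_bilinear_inner D D], of 1])
      (rule n1)
  thus o12: "\<xi> s \<bullet> xi2 I \<xi> s = 0"
    using K1_pos assms by (auto simp: inner_commute)
  show "xi3 I \<xi> s \<bullet> xi3 I \<xi> s = 1" using n1[OF assms] n2 o12
    by (simp add: xi3_def dot_cross inner_commute)
  show "\<xi> s \<bullet> xi3 I \<xi> s = 0" "xi2 I \<xi> s \<bullet> xi3 I \<xi> s = 0"
    by (simp_all add: xi3_def dot_cross_self)
qed

section \<open>The direction of the angular velocity\<close>

text \<open>
  The torsion is defined through a derivative of \<open>xi2\<close>, so its own differentiability has to be
  extracted from the smoothness of \<open>\<xi>\<close>: differentiating \<open>\<langle>\<xi>3, \<xi>'\<rangle> = 0\<close> yields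
  \<open>\<langle>\<xi>3, \<xi>''\<rangle> = K1 K2\<close>, so that \<open>K2 / K1 = \<langle>\<xi>3, \<xi>''\<rangle> / \<langle>\<xi>', \<xi>'\<rangle>\<close>.
\<close>

lemma torsion_ratio_differentiable:
  assumes "s \<in> I"
  shows "(torsion_ratio has_field_derivative deriv_along I torsion_ratio s) (at s within I)"
proof -
  obtain F where F0: "\<And>t. t \<in> I \<Longrightarrow> F 0 t = \<xi> t"
    and F: "\<And>n t. t \<in> I \<Longrightarrow> (F n has_vector_derivative F (Suc n) t) (at t within I)"
    using smooth unfolding smooth_along_def by metis
  have F1: "F 1 t = K1 I \<xi> t *\<^sub>R xi2 I \<xi> t" if t: "t \<in> I" for t
  proof -
    have "(\<xi> has_vector_derivative F 1 t) (at t within I)"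
      by (rule has_vector_derivative_transform[OF t _ F[OF t, of 0, folded One_nat_def]])
        (simp add: F0)
    thus ?thesis using deriv_unique[OF t] frenet(1)[OF t] by blast
  qed
  have F2: "xi3 I \<xi> t \<bullet> F 2 t = K1 I \<xi> t * K2 I \<xi> t" if t: "t \<in> I" for t
  proof -
    have "xi3 I \<xi> t \<bullet> F (Suc 1) t + (- K2 I \<xi> t *\<^sub>R xi2 I \<xi> t) \<bullet> F 1 t = 0"
      by (rule deriv_of_constant_zero[OF t
            bounded_bilinear.has_vector_derivative[OF bounded_bilinear_inner
              frenet(3)[OF t] F[OF t, of 1]], of 0])
        (use F1 frame_orthonormal in \<open>simp add: inner_commute\<close>)
    thus ?thesis using frame_orthonormal[OF t] F1[OF t] by (simp add: numeral_2_eq_2)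
  qed
  have eq: "torsion_ratio t = (xi3 I \<xi> t \<bullet> F 2 t) / (F 1 t \<bullet> F 1 t)" if t: "t \<in> I" for t
    using F1[OF t] F2[OF t] frame_orthonormal[OF t] K1_pos t by (simp add: torsion_ratio_def)
  have nz: "F 1 s \<bullet> F 1 s \<noteq> 0"
    using F1[OF assms] frame_orthonormal[OF assms] K1_pos assms by force
  have num: "((\<lambda>t. xi3 I \<xi> t \<bullet> F 2 t) has_field_derivative
      xi3 I \<xi> s \<bullet> F (Suc 2) s + (- K2 I \<xi> s *\<^sub>R xi2 I \<xi> s) \<bullet> F 2 s) (at s within I)"
    unfolding has_real_derivative_iff_has_vector_derivative
    by (rule bounded_bilinear.has_vector_derivative[OF bounded_bilinear_inner
          frenet(3)[OF assms] F[OF assms]])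
  have den: "((\<lambda>t. F 1 t \<bullet> F 1 t) has_field_derivative
      F 1 s \<bullet> F (Suc 1) s + F (Suc 1) s \<bullet> F 1 s) (at s within I)"
    unfolding has_real_derivative_iff_has_vector_derivative
    by (rule bounded_bilinear.has_vector_derivative[OF bounded_bilinear_inner
          F[OF assms] F[OF assms]])
  obtain D where "((\<lambda>t. (xi3 I \<xi> t \<bullet> F 2 t) / (F 1 t \<bullet> F 1 t)) has_vector_derivative D)
      (at s within I)"
    using DERIV_divide[OF num den nz] unfolding has_real_derivative_iff_has_vector_derivative
    by blast
  from has_vector_derivative_transform[OF assms eq this]
  have D: "(torsion_ratio has_vector_derivative D) (at s within I)" by simp
  with vector_derivative_within[OF at_within_parameter_interval[OF interval assms] D]
  show ?thesis by (simp add: has_real_derivative_iff_has_vector_derivative)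
qed

text \<open>
  Since \<open>K1\<close> is positive, \<open>sqrt (K1\<^sup>2 + K2\<^sup>2) = K1 sqrt (1 + q\<^sup>2)\<close>; this brings \<open>\<sigma>\<close> into the form in
  which the derivative of \<open>W\<close> arises.
\<close>

lemma slant_sigma_eq:
  assumes "s \<in> I"
  shows "slant_sigma I \<xi> s =
    deriv_along I torsion_ratio s / (K1 I \<xi> s * sqrt (1 + (torsion_ratio s)\<^sup>2) ^ 3)"
proof -
  define k q where "k = K1 I \<xi> s" and "q = torsion_ratio s"
  have k: "k > 0" using K1_pos assms by (simp add: k_def)
  have sq: "sqrt (k\<^sup>2 + (q * k)\<^sup>2) = k * sqrt (1 + q\<^sup>2)"
  proof -
    have "k\<^sup>2 + (q * k)\<^sup>2 = k\<^sup>2 * (1 + q\<^sup>2)" by (simp add: algebra_simps power2_eq_square)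
    thus ?thesis using k by (simp add: real_sqrt_mult)
  qed
  have "(k\<^sup>2 + (q * k)\<^sup>2) powr (3/2) = sqrt (k\<^sup>2 + (q * k)\<^sup>2) ^ 3"
  proof -
    have "(k\<^sup>2 + (q * k)\<^sup>2) > 0" using k by (simp add: add_pos_nonneg)
    hence "((k\<^sup>2 + (q * k)\<^sup>2) powr (1/2)) powr 3 = sqrt (k\<^sup>2 + (q * k)\<^sup>2) ^ 3"
      by (simp only: powr_half_sqrt less_imp_le powr_numeral real_sqrt_ge_zero)
    thus ?thesis unfolding powr_powr by simp
  qed
  hence pw: "(k\<^sup>2 + (q * k)\<^sup>2) powr (3/2) = k ^ 3 * sqrt (1 + q\<^sup>2) ^ 3"
    by (simp only: sq) (simp add: power_mult_distrib)
  have "slant_sigma I \<xi> s = k\<^sup>2 / (k ^ 3 * sqrt (1 + q\<^sup>2) ^ 3) * deriv_along I torsion_ratio s"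
    unfolding slant_sigma_def K2_eq[OF assms] k_def[symmetric] q_def[symmetric] pw
    by (simp add: torsion_ratio_def[abs_def])
  also have "\<dots> = deriv_along I torsion_ratio s / (k * sqrt (1 + q\<^sup>2) ^ 3)"
    using k by (simp add: power2_eq_square power3_eq_cube)
  finally show ?thesis by (simp add: k_def q_def)
qed

text \<open>
  The frame rotates instantaneously about \<open>W\<close>, so only the change of the coefficients of \<open>W\<close> with
  respect to the frame contributes to \<open>W'\<close>. These coefficients are \<open>cos \<phi>\<close> and \<open>sin \<phi>\<close> with
  \<open>cot \<phi> = q\<close>, hence \<open>W' = \<phi>' (- sin \<phi> \<xi>1 + cos \<phi> \<xi>3)\<close>, whereas
  \<open>\<xi>2' = sqrt (K1\<^sup>2 + K2\<^sup>2) (- sin \<phi> \<xi>1 + cos \<phi> \<xi>3)\<close>, and \<open>\<sigma> = - \<phi>' / sqrt (K1\<^sup>2 + K2\<^sup>2)\<close>.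
\<close>

lemma deriv_darboux_axis:
  assumes s: "s \<in> I"
  shows "(darboux_axis has_vector_derivative
    - slant_sigma I \<xi> s *\<^sub>R (- K1 I \<xi> s *\<^sub>R \<xi> s + K2 I \<xi> s *\<^sub>R xi3 I \<xi> s)) (at s within I)"
proof -
  define k q q' u where "k = K1 I \<xi> s" and "q = torsion_ratio s"
    and "q' = deriv_along I torsion_ratio s" and "u = sqrt (1 + q\<^sup>2)"
  have k: "k > 0" using K1_pos s by (simp add: k_def)
  have p: "1 + q\<^sup>2 > 0" by (simp add: add_pos_nonneg)
  hence u: "u > 0" "u\<^sup>2 = 1 + q\<^sup>2" by (simp_all add: u_def)
  have dq: "(torsion_ratio has_field_derivative q') (at s within I)"
    using torsion_ratio_differentiable[OF s] by (simp add: q'_def)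
  have du: "((\<lambda>t. sqrt (1 + (torsion_ratio t)\<^sup>2)) has_field_derivative q * q' / u) (at s within I)"
  proof -
    have "((\<lambda>t. 1 + (torsion_ratio t)\<^sup>2) has_field_derivative 2 * q * q') (at s within I)"
      using DERIV_add[OF DERIV_const[of 1] DERIV_power[OF dq, of 2]] by (simp add: q_def mult_ac)
    from DERIV_chain2[OF DERIV_real_sqrt[OF p[unfolded q_def]] this] show ?thesis
      unfolding q_def[symmetric] u_def[symmetric] by (simp add: field_simps)
  qed
  have dA: "((\<lambda>t. torsion_ratio t / sqrt (1 + (torsion_ratio t)\<^sup>2)) has_field_derivative q' / u ^ 3)
      (at s within I)"
  proof -
    have "((\<lambda>t. torsion_ratio t / sqrt (1 + (torsion_ratio t)\<^sup>2)) has_field_derivative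
        (q' * u - q * (q * q' / u)) / (u * u)) (at s within I)"
      using DERIV_divide[OF dq du] u unfolding q_def[symmetric] u_def[symmetric] by simp
    moreover have "q' * u - q * (q * q' / u) = q' * (u\<^sup>2 - q\<^sup>2) / u"
      using u(1) by (simp add: field_simps power2_eq_square)
    ultimately show ?thesis using u by (simp add: power3_eq_cube mult.assoc)
  qed
  have dB: "((\<lambda>t. 1 / sqrt (1 + (torsion_ratio t)\<^sup>2)) has_field_derivative - (q * q') / u ^ 3)
      (at s within I)"
    using DERIV_divide[OF DERIV_const[of 1] du] u
    unfolding q_def[symmetric] u_def[symmetric] by (simp add: power3_eq_cube mult.assoc)
  have "(darboux_axis has_vector_derivative
      (q / u) *\<^sub>R (k *\<^sub>R xi2 I \<xi> s) + (q' / u ^ 3) *\<^sub>R \<xi> s +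
      ((1 / u) *\<^sub>R (- K2 I \<xi> s *\<^sub>R xi2 I \<xi> s) + (- (q * q') / u ^ 3) *\<^sub>R xi3 I \<xi> s)) (at s within I)"
    unfolding darboux_axis_def[abs_def]
    using has_vector_derivative_add[OF
        has_vector_derivative_scaleR[OF dA frenet(1)[OF s]]
        has_vector_derivative_scaleR[OF dB frenet(3)[OF s]]]
    by (simp add: k_def q_def u_def)
  moreover have "(q / u) *\<^sub>R (k *\<^sub>R xi2 I \<xi> s) + (q' / u ^ 3) *\<^sub>R \<xi> s +
      ((1 / u) *\<^sub>R (- K2 I \<xi> s *\<^sub>R xi2 I \<xi> s) + (- (q * q') / u ^ 3) *\<^sub>R xi3 I \<xi> s) =
      - slant_sigma I \<xi> s *\<^sub>R (- K1 I \<xi> s *\<^sub>R \<xi> s + K2 I \<xi> s *\<^sub>R xi3 I \<xi> s)"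
    unfolding slant_sigma_eq[OF s] K2_eq[OF s] k_def[symmetric] q_def[symmetric]
      q'_def[symmetric] u_def[symmetric]
    using k u(1) by (simp add: scaleR_add_right scaleR_diff_right mult.commute)
  ultimately show ?thesis by simp
qed

section \<open>Slant helices and constancy of \<open>\<sigma>\<close>\<close>

text \<open>
  The first integral \<open>W + c \<xi>2\<close> is the axis up to its length \<open>sqrt (1 + c\<^sup>2)\<close>, so that the cosine
  of the angle is \<open>c / sqrt (1 + c\<^sup>2)\<close>.
\<close>

lemma slant_helix_if_constant_sigma:
  assumes c: "\<And>s. s \<in> I \<Longrightarrow> slant_sigma I \<xi> s = c"
  shows "slant_helix I \<xi>"
proof -
  have deriv: "((\<lambda>t. darboux_axis t + c *\<^sub>R xi2 I \<xi> t) has_vector_derivative 0) (at s within I)"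
    if "s \<in> I" for s
    using has_vector_derivative_add[OF deriv_darboux_axis[OF that]
        bounded_linear.has_vector_derivative[OF bounded_linear_scaleR_right
          frenet(2)[OF that], of c]]
    by (simp add: c[OF that])
  obtain D where D: "\<And>s. s \<in> I \<Longrightarrow> darboux_axis s + c *\<^sub>R xi2 I \<xi> s = D"
    using deriv_zero_imp_constant[OF deriv] by blast
  define m where "m = sqrt (1 + c\<^sup>2)"
  have m: "m > 0" "m\<^sup>2 = 1 + c\<^sup>2" by (simp_all add: m_def add_pos_nonneg)
  have D2: "xi2 I \<xi> s \<bullet> D = c" if "s \<in> I" for s
    using frame_orthonormal[OF that] unfolding D[OF that, symmetric] darboux_axis_def
    by (simp add: inner_add_right inner_commute)
  obtain s where s: "s \<in> I"
    using interval interior_subset by (fastforce simp: parameter_interval_def)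
  have "norm D = m"
  proof -
    define q where "q = torsion_ratio s"
    have p: "1 + q\<^sup>2 > 0" by (simp add: add_pos_nonneg)
    have WW: "darboux_axis s \<bullet> darboux_axis s = 1"
    proof -
      have "darboux_axis s \<bullet> darboux_axis s = (q\<^sup>2 + 1) / (sqrt (1 + q\<^sup>2))\<^sup>2"
        using frame_orthonormal[OF s] unfolding darboux_axis_def q_def[symmetric]
        by (simp add: inner_add_right inner_add_left inner_commute power2_eq_square
            add_divide_distrib)
      thus ?thesis using p by simp
    qed
    have "darboux_axis s \<bullet> xi2 I \<xi> s = 0"
      using frame_orthonormal[OF s] unfolding darboux_axis_def
      by (simp add: inner_add_left inner_commute[of "xi3 I \<xi> s" "xi2 I \<xi> s"])
    hence "D \<bullet> D = m\<^sup>2"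
      using WW frame_orthonormal[OF s] m unfolding D[OF s, symmetric]
      by (simp add: inner_add_right inner_add_left inner_commute power2_eq_square)
    thus ?thesis using m(1) unfolding norm_eq_sqrt_inner by simp
  qed
  have "\<bar>c\<bar> \<le> m" unfolding m_def by (rule real_le_rsqrt) simp
  hence r: "- 1 \<le> c / m" "c / m \<le> 1" using m by (simp_all add: field_simps)
  have "makes_constant_angle I (xi2 I \<xi>) ((1 / m) *\<^sub>R D) (arccos (c / m))"
    unfolding makes_constant_angle_def
    using \<open>norm D = m\<close> m r D2 by (simp add: arccos_lbound arccos_ubound)
  thus ?thesis unfolding slant_helix_def by blast
qed

text \<open>
  The sign is uniform in \<open>s\<close> because \<open>\<langle>W, d\<rangle> = \<plusminus> sin \<theta>\<close> is constant along the curve, not only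
  its square.
\<close>

lemma constant_angle_imp_cot:
  assumes "makes_constant_angle I (xi2 I \<xi>) d \<theta>"
  shows "sin \<theta> \<noteq> 0 \<and> (\<exists>\<epsilon>\<in>{-1, 1}. \<forall>s\<in>I. cot \<theta> = \<epsilon> * slant_sigma I \<xi> s)"
proof -
  have d: "norm d = 1" and ang: "\<And>s. s \<in> I \<Longrightarrow> xi2 I \<xi> s \<bullet> d = cos \<theta>"
    using assms by (auto simp: makes_constant_angle_def)
  have dot: "((\<lambda>t. f t \<bullet> d) has_vector_derivative f' \<bullet> d) (at s within I)"
    if "(f has_vector_derivative f') (at s within I)" for f f' s
    by (rule bounded_linear.has_vector_derivative[OF bounded_linear_inner_left that])
  have perp: "(- K1 I \<xi> s *\<^sub>R \<xi> s + K2 I \<xi> s *\<^sub>R xi3 I \<xi> s) \<bullet> d = 0" if "s \<in> I" for s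
    by (rule deriv_of_constant_zero[OF that dot[OF frenet(2)[OF that]] ang])
  have deriv: "((\<lambda>t. darboux_axis t \<bullet> d) has_vector_derivative 0) (at s within I)" if "s \<in> I" for s
    using dot[OF deriv_darboux_axis[OF that]] perp[OF that] by simp
  obtain w where w: "\<And>s. s \<in> I \<Longrightarrow> darboux_axis s \<bullet> d = w"
    using deriv_zero_imp_constant[OF deriv] by blast
  have ratio: "\<xi> s \<bullet> d = torsion_ratio s * (xi3 I \<xi> s \<bullet> d)" if "s \<in> I" for s
  proof -
    have "K1 I \<xi> s * (\<xi> s \<bullet> d) = K1 I \<xi> s * (torsion_ratio s * (xi3 I \<xi> s \<bullet> d))"
      using perp[OF that] unfolding K2_eq[OF that] inner_add_left inner_scaleR_left by (simp only: mult_ac mult_minus_left mult_minus_right)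
    thus ?thesis using K1_pos that by (metis less_irrefl mult_left_cancel)
  qed
  have w_eq: "w = (xi3 I \<xi> s \<bullet> d) * sqrt (1 + (torsion_ratio s)\<^sup>2)" if "s \<in> I" for s
  proof -
    define q b u where "q = torsion_ratio s" and "b = xi3 I \<xi> s \<bullet> d" and "u = sqrt (1 + q\<^sup>2)"
    have u: "u > 0" "u * u = 1 + q\<^sup>2" by (simp_all add: u_def add_pos_nonneg)
    have "w = q / u * (q * b) + 1 / u * b"
      using w[OF that] ratio[OF that] unfolding darboux_axis_def q_def b_def u_def
      by (simp add: inner_add_left)
    also have "\<dots> = b * (u * u) / u"
      unfolding u(2) by (simp add: field_simps power2_eq_square add_divide_distrib)
    also have "\<dots> = b * u" using u(1) by simp
    finally show ?thesis by (simp add: q_def b_def u_def)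
  qed
  have cos_eq: "cos \<theta> = slant_sigma I \<xi> s * w" if s: "s \<in> I" for s
  proof -
    define k q q' b u where "k = K1 I \<xi> s" and "q = torsion_ratio s"
      and "q' = deriv_along I torsion_ratio s" and "b = xi3 I \<xi> s \<bullet> d" and "u = sqrt (1 + q\<^sup>2)"
    have k: "k > 0" using K1_pos s by (simp add: k_def)
    have u: "u > 0" "u\<^sup>2 = 1 + q\<^sup>2" by (simp_all add: u_def add_pos_nonneg)
    have dq: "(torsion_ratio has_vector_derivative q') (at s within I)"
      using torsion_ratio_differentiable[OF s]
      by (simp add: has_real_derivative_iff_has_vector_derivative q'_def)
    \<comment> \<open>In the form \<open>\<langle>\<xi>1, d\<rangle> = q \<langle>\<xi>3, d\<rangle>\<close> the relation \<open>\<langle>\<xi>2', d\<rangle> = 0\<close> can be differentiated again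
       without the individual derivatives of \<open>K1\<close> and \<open>K2\<close>.\<close>
    have "(K1 I \<xi> s *\<^sub>R xi2 I \<xi> s) \<bullet> d -
        (torsion_ratio s * ((- K2 I \<xi> s *\<^sub>R xi2 I \<xi> s) \<bullet> d) + q' * (xi3 I \<xi> s \<bullet> d)) = 0"
      by (rule deriv_of_constant_zero[OF s has_vector_derivative_diff[OF
              dot[OF frenet(1)[OF s]]
              has_vector_derivative_mult[OF dq dot[OF frenet(3)[OF s]]]], of 0])
        (simp add: ratio)
    hence "k * u\<^sup>2 * cos \<theta> = q' * b"
      unfolding u(2) using ang[OF s] K2_eq[OF s]
      by (simp add: k_def q_def b_def algebra_simps power2_eq_square)
    moreover have "slant_sigma I \<xi> s * w = q' * b / (k * u\<^sup>2)"
      unfolding slant_sigma_eq[OF s] w_eq[OF s] using k u(1)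
      unfolding k_def[symmetric] q_def[symmetric] b_def[symmetric] q'_def[symmetric]
        u_def[symmetric]
      by (simp add: power3_eq_cube power2_eq_square)
    ultimately have "slant_sigma I \<xi> s * w = k * u\<^sup>2 * cos \<theta> / (k * u\<^sup>2)" by simp
    thus ?thesis using k u(1) by simp
  qed
  obtain s where s: "s \<in> I"
    using interval interior_subset by (fastforce simp: parameter_interval_def)
  have w2: "w\<^sup>2 = (sin \<theta>)\<^sup>2"
  proof -
    have "d \<bullet> d = (d \<bullet> \<xi> s)\<^sup>2 + (d \<bullet> xi2 I \<xi> s)\<^sup>2 + (d \<bullet> xi3 I \<xi> s)\<^sup>2"
      using arg_cong[OF orthonormal_expansion[OF frame_orthonormal(1,2,4)[OF s], of d],
          of "\<lambda>v. d \<bullet> v"]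
      by (simp add: xi3_def inner_add_right power2_eq_square)
    hence "1 = (torsion_ratio s * (xi3 I \<xi> s \<bullet> d))\<^sup>2 + (cos \<theta>)\<^sup>2 + (xi3 I \<xi> s \<bullet> d)\<^sup>2"
      using d ratio[OF s] ang[OF s] by (simp add: dot_square_norm inner_commute)
    moreover have "w\<^sup>2 = (xi3 I \<xi> s \<bullet> d)\<^sup>2 * (1 + (torsion_ratio s)\<^sup>2)"
      unfolding w_eq[OF s] by (simp add: power_mult_distrib)
    ultimately show ?thesis
      by (simp add: sin_squared_eq algebra_simps power_mult_distrib)
  qed
  have nz: "sin \<theta> \<noteq> 0"
  proof
    assume 0: "sin \<theta> = 0"
    hence "w = 0" using w2 by simp
    hence "cos \<theta> = 0" using cos_eq[OF s] by simp
    with 0 show False using sin_cos_squared_add[of \<theta>] by simp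
  qed
  have "w = sin \<theta> \<or> w = - sin \<theta>" using w2 by (simp add: power2_eq_iff)
  then obtain \<epsilon> :: real where e: "\<epsilon> \<in> {-1, 1}" "w = \<epsilon> * sin \<theta>" by force
  have "cot \<theta> = \<epsilon> * slant_sigma I \<xi> s" if "s \<in> I" for s
    using cos_eq[OF that] e nz by (simp add: cot_def)
  with e nz show ?thesis by blast
qed

end

theorem theorem5:
  fixes I :: "real set" and r \<xi> :: "real \<Rightarrow> real^3" and \<pi> :: "real \<Rightarrow> (real^3) set"
  assumes "myller_configuration I r \<xi> \<pi>"
    and "\<forall>s\<in>I. K1 I \<xi> s > 0"
    and "\<forall>s\<in>I. (K1 I \<xi> s, K2 I \<xi> s) \<noteq> (0, 0)"
  shows "(slant_helix I \<xi> \<longleftrightarrow> (\<exists>c. \<forall>s\<in>I. slant_sigma I \<xi> s = c)) \<and>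
    (\<forall>d \<theta>. makes_constant_angle I (xi2 I \<xi>) d \<theta> \<longrightarrow>
       sin \<theta> \<noteq> 0 \<and> (\<exists>\<epsilon>\<in>{-1, 1}. \<forall>s\<in>I. cot \<theta> = \<epsilon> * slant_sigma I \<xi> s))"
proof -
  interpret frenet_type_frame I \<xi>
    using assms by unfold_locales (auto simp: myller_configuration_def)
  have "\<exists>c. \<forall>s\<in>I. slant_sigma I \<xi> s = c" if helix: "slant_helix I \<xi>"
  proof -
    from helix obtain d \<theta> where "makes_constant_angle I (xi2 I \<xi>) d \<theta>"
      unfolding slant_helix_def by blast
    from constant_angle_imp_cot[OF this] obtain \<epsilon> :: real
      where "\<epsilon> \<in> {-1, 1}" and "\<forall>s\<in>I. cot \<theta> = \<epsilon> * slant_sigma I \<xi> s" by blast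
    hence "\<forall>s\<in>I. slant_sigma I \<xi> s = \<epsilon> * cot \<theta>" by auto
    thus ?thesis by blast
  qed
  thus ?thesis using slant_helix_if_constant_sigma constant_angle_imp_cot by blast
qed

end
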